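(* Let $\succsim$ be a weak order on $F$ and $(\succsim_A)_{A\in\Sigma}$ a family of weak orders on $F$ satisfying axioms (P1½)–(P6½), (SE) and (P0½) (stated in the context). Then for each non-empty event $A$ and each triple of acts $f,g,h$: $f\succ_A g$ if and only if $fAh\succ gAh$ and, for each constant act $k$, there exists a finite partition $(A_i)_{i=1}^n$ of $A$ into events such that, for each $i=1,\dots,n$, $$kA_i(fAh)\succ gAh\qquad\text{and}\qquad fAh\succ kA_i(gAh).$$
   Context: Framework. $S$ is an infinite set (states), $\Sigma\subseteq 2^S$ is a $\sigma$-algebra (its elements are called events), $O$ is a set (outcomes). $F$ is the set of acts: functions $f:S\to O$ with finite range and $f^{-1}(o)\in\Sigma$ for every $o\in O$. A constant act is an act with constant value. A weak order is a complete and transitive binary relation; for a weak order $\succsim$, $f\succ g$ means $f\succsim g$ and not $g\succsim f$, and $f\sim g$ means $f\succsim g$ and $g\succsim f$. $\succsim$ is a weak order on $F$ and, for each event $A$ (including $\varnothing$), $\succsim_A$ is a weak order on $F$. For an event $A$ and acts $f,g$, $fAg$ is the act equal to $f$ on $A$ and to $g$ on $S\setminus A$. $\succsim_A$ agrees with $\succsim_B$ if for all acts $f,g$: $f\succsim_A g\Leftrightarrow f\succsim_B g$. For events $B\subseteq A$, $B$ is null at $A$ if $\succsim_{A\setminus B}$ agrees with $\succsim_A$; otherwise $B$ is non-null at $A$. Axioms. (P1½) For every event $A$ and acts $f,g$: $f\succsim_A g$ implies $fAh\succsim_A gAh$ for every act $h$; and $fAh\succsim_A gAh$ for some act $h$ implies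 $f\succsim_A g$. (P2½) For all events $B\subseteq A$ and acts $f,g$: $f\succsim_B g$ and $f\succsim_{A\setminus B}g$ imply $f\succsim_A g$; and if $B$ is non-null at $A$, then $f\succ_B g$ and $f\succsim_{A\setminus B}g$ imply $f\succ_A g$. (P3½) For every non-empty event $A$ and constant acts $f,g$: $f\succsim_A g\Leftrightarrow f\succsim_S g$. (P4½) For all events $A,B,C$ with $B,C\subseteq A$ and constant acts $f,f',g,g'$ with $f\succ_S f'$ and $g\succ_S g'$: $fBf'\succsim_A fCf'$ implies $gBg'\succsim_A gCg'$. (P5½) There exist constant acts $f,g$ with $f\succ_S g$. (P6½) For every non-empty event $A$ and acts $f,g,h$ with $f\succ_A g$ and $h$ constant, there is a finite partition of $A$ into events $A_1,\dots,A_n$ such that for each $i$: $f\succ_A hA_ig$ and $hA_if\succ_A g$. (SE) There is a family $\mathcal{E}\subseteq\Sigma\setminus\{\varnothing\}$ such that: (a) for every $B\in\Sigma$, if $\succsim_E$ agrees with $\succsim_{E\setminus B}$ for all $E\in\mathcal{E}$ with $B\subseteq E$, then $\succsim_A$ agrees with $\succsim_{A\setminus B}$ for all $A\in\Sigma$ with $B\subseteq A$; (b) for all $A\in\Sigma$ and $E\in\mathcal{E}$ with $E\subseteq A$, either $\succsim_A$ agrees with $\succsim_{A\setminus E}$ or $\succsim_A$ agrees with $\succsim_E$. (P0½) For the family $\mathcal{E}$ of (SE) and all acts $f,g$: $f\succsim g$ if and only if for every $E\in\mathcal{E}$ with $g\succ_E f$ there is $E'\in\mathcal{E}$ with $E'\supseteq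 E$ and $f\succ_{E'}g$. *)

theory Defs
  imports "HOL-Analysis.Analysis"
begin

(* The state space S is the whole type 's and the set O of outcomes the whole type 'o.
   Events are the members of a sigma-algebra Sig on UNIV :: 's set.  A relation is only
   ever consulted on acts; its values elsewhere are irrelevant. *)

type_synonym ('s, 'o) preference = "('s \<Rightarrow> 'o) \<Rightarrow> ('s \<Rightarrow> 'o) \<Rightarrow> bool"

definition acts :: "'s set set \<Rightarrow> ('s \<Rightarrow> 'o) set" where
  "acts Sig = {f. finite (range f) \<and> (\<forall>c. f -` {c} \<in> Sig)}"

definition const_acts :: "'s set set \<Rightarrow> ('s \<Rightarrow> 'o) set" where
  "const_acts Sig = {f \<in> acts Sig. f constant_on UNIV}"

definition weak_order_on :: "'a set \<Rightarrow> ('a \<Rightarrow> 'a \<Rightarrow> bool) \<Rightarrow> bool" where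
  "weak_order_on F R \<longleftrightarrow> (\<forall>f\<in>F. \<forall>g\<in>F. R f g \<or> R g f) \<and> transp_on F R"

definition strict :: "('a \<Rightarrow> 'a \<Rightarrow> bool) \<Rightarrow> 'a \<Rightarrow> 'a \<Rightarrow> bool" where
  "strict R f g \<longleftrightarrow> R f g \<and> \<not> R g f"

(* mix f A g equals f on A and g elsewhere; note the argument order of override_on *)
abbreviation mix :: "('s \<Rightarrow> 'o) \<Rightarrow> 's set \<Rightarrow> ('s \<Rightarrow> 'o) \<Rightarrow> 's \<Rightarrow> 'o" where
  "mix f A g \<equiv> override_on g f A"

definition agrees :: "'s set set \<Rightarrow> ('s, 'o) preference \<Rightarrow> ('s, 'o) preference \<Rightarrow> bool" where
  "agrees Sig R R' \<longleftrightarrow> (\<forall>f\<in>acts Sig. \<forall>g\<in>acts Sig. R f g \<longleftrightarrow> R' f g)"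

(* Below, C A is the conditional preference given the event A. *)

definition null_at :: "'s set set \<Rightarrow> ('s set \<Rightarrow> ('s, 'o) preference) \<Rightarrow> 's set \<Rightarrow> 's set \<Rightarrow> bool" where
  "null_at Sig C B A \<longleftrightarrow> agrees Sig (C (A - B)) (C A)"

(* partition_on requires the cells of a partition to be non-empty *)
definition finite_event_partition :: "'s set set \<Rightarrow> 's set \<Rightarrow> 's set set \<Rightarrow> bool" where
  "finite_event_partition Sig A P \<longleftrightarrow> finite P \<and> P \<subseteq> Sig \<and> partition_on A P"

definition P1_half :: "'s set set \<Rightarrow> ('s set \<Rightarrow> ('s, 'o) preference) \<Rightarrow> bool" where
  "P1_half Sig C \<longleftrightarrow>
    (\<forall>A\<in>Sig. \<forall>f\<in>acts Sig. \<forall>g\<in>acts Sig.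
       (C A f g \<longrightarrow> (\<forall>h\<in>acts Sig. C A (mix f A h) (mix g A h))) \<and>
       ((\<exists>h\<in>acts Sig. C A (mix f A h) (mix g A h)) \<longrightarrow> C A f g))"

definition P2_half :: "'s set set \<Rightarrow> ('s set \<Rightarrow> ('s, 'o) preference) \<Rightarrow> bool" where
  "P2_half Sig C \<longleftrightarrow>
    (\<forall>A\<in>Sig. \<forall>B\<in>Sig. \<forall>f\<in>acts Sig. \<forall>g\<in>acts Sig. B \<subseteq> A \<longrightarrow>
       (C B f g \<and> C (A - B) f g \<longrightarrow> C A f g) \<and>
       (\<not> null_at Sig C B A \<and> strict (C B) f g \<and> C (A - B) f g \<longrightarrow> strict (C A) f g))"

definition P3_half :: "'s set set \<Rightarrow> ('s set \<Rightarrow> ('s, 'o) preference) \<Rightarrow> bool" where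
  "P3_half Sig C \<longleftrightarrow>
    (\<forall>A\<in>Sig. \<forall>f\<in>const_acts Sig. \<forall>g\<in>const_acts Sig. A \<noteq> {} \<longrightarrow>
       (C A f g \<longleftrightarrow> C UNIV f g))"

definition P4_half :: "'s set set \<Rightarrow> ('s set \<Rightarrow> ('s, 'o) preference) \<Rightarrow> bool" where
  "P4_half Sig C \<longleftrightarrow>
    (\<forall>A\<in>Sig. \<forall>B\<in>Sig. \<forall>D\<in>Sig.
     \<forall>f\<in>const_acts Sig. \<forall>f'\<in>const_acts Sig. \<forall>g\<in>const_acts Sig. \<forall>g'\<in>const_acts Sig.
       B \<subseteq> A \<and> D \<subseteq> A \<and> strict (C UNIV) f f' \<and> strict (C UNIV) g g' \<longrightarrow>
       C A (mix f B f') (mix f D f') \<longrightarrow> C A (mix g B g') (mix g D g'))"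

definition P5_half :: "'s set set \<Rightarrow> ('s set \<Rightarrow> ('s, 'o) preference) \<Rightarrow> bool" where
  "P5_half Sig C \<longleftrightarrow> (\<exists>f\<in>const_acts Sig. \<exists>g\<in>const_acts Sig. strict (C UNIV) f g)"

definition P6_half :: "'s set set \<Rightarrow> ('s set \<Rightarrow> ('s, 'o) preference) \<Rightarrow> bool" where
  "P6_half Sig C \<longleftrightarrow>
    (\<forall>A\<in>Sig. \<forall>f\<in>acts Sig. \<forall>g\<in>acts Sig. \<forall>h\<in>const_acts Sig.
       A \<noteq> {} \<and> strict (C A) f g \<longrightarrow>
       (\<exists>P. finite_event_partition Sig A P \<and>
            (\<forall>B\<in>P. strict (C A) f (mix h B g) \<and> strict (C A) (mix h B f) g)))"

definition SE :: "'s set set \<Rightarrow> ('s set \<Rightarrow> ('s, 'o) preference) \<Rightarrow> 's set set \<Rightarrow> bool" where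
  "SE Sig C \<E> \<longleftrightarrow>
    \<E> \<subseteq> Sig - {{}} \<and>
    (\<forall>B\<in>Sig.
       (\<forall>E\<in>\<E>. B \<subseteq> E \<longrightarrow> agrees Sig (C E) (C (E - B))) \<longrightarrow>
       (\<forall>A\<in>Sig. B \<subseteq> A \<longrightarrow> agrees Sig (C A) (C (A - B)))) \<and>
    (\<forall>A\<in>Sig. \<forall>E\<in>\<E>. E \<subseteq> A \<longrightarrow>
       agrees Sig (C A) (C (A - E)) \<or> agrees Sig (C A) (C E))"

definition P0_half :: "'s set set \<Rightarrow> ('s, 'o) preference \<Rightarrow> ('s set \<Rightarrow> ('s, 'o) preference)
    \<Rightarrow> 's set set \<Rightarrow> bool" where
  "P0_half Sig R C \<E> \<longleftrightarrow>
    (\<forall>f\<in>acts Sig. \<forall>g\<in>acts Sig.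
       R f g \<longleftrightarrow>
       (\<forall>E\<in>\<E>. strict (C E) g f \<longrightarrow> (\<exists>E'\<in>\<E>. E \<subseteq> E' \<and> strict (C E') f g)))"

end

theory Submission
  imports Defs
begin

text \<open>
  Why the theorem holds.  After replacing \<open>f\<close> and \<open>g\<close> by \<open>mix f A h\<close> and \<open>mix g A h\<close>, which
  \<open>C A\<close> cannot distinguish from them, the two acts coincide outside \<open>A\<close>.  For such acts, a
  conditional preference \<open>C E\<close> with \<open>A \<subseteq> E\<close> can only repeat the verdict of \<open>C A\<close>, or, if \<open>A\<close> is
  null at \<open>E\<close>, be indifferent (\<open>cond_iff_local\<close>).

  Forward direction (\<open>strict_cond_imp_strict\<close>).  Let \<open>f\<close> be strictly better given \<open>A\<close>.  The family
  \<open>\<E>\<close> is rich enough that every non-empty event is non-null at some member of \<open>\<E>\<close> containing it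
  (\<open>ex_non_null\<close>).  Applied to \<open>A\<close>, this gives a member of \<open>\<E>\<close> at which \<open>f\<close> is strictly better, and
  no larger event ever reverses that verdict.  Conversely, a member \<open>E\<close> of \<open>\<E>\<close> at which \<open>g\<close> is
  strictly better is overruled: take \<open>E'\<close> in \<open>\<E>\<close> at which \<open>A \<union> E\<close> is non-null.  Were \<open>A\<close> null at
  \<open>E'\<close>, then \<open>E\<close> would be non-null there, and hence so would \<open>A \<inter> E\<close>, the part of \<open>E\<close> on which the
  verdict at \<open>E\<close> rests; but \<open>A \<inter> E\<close> lies inside the null event \<open>A\<close>.  So \<open>A\<close> is non-null at \<open>E'\<close>
  and \<open>f\<close> is strictly better at \<open>E'\<close>.  Thus \<open>f\<close> is strictly preferred unconditionally, and the
  continuity axiom for \<open>C A\<close> makes this preference robust under small changes to a constant.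

  Backward direction.  By the forward direction, it only has to be excluded that \<open>f\<close> and \<open>g\<close> are
  indifferent given \<open>A\<close>.  In that case, robustness says that changing \<open>g\<close> into \<open>k\<close> on a single
  cell never improves on \<open>f\<close>, hence never improves on \<open>g\<close>, given \<open>A\<close>; these local comparisons add
  up over the cells (\<open>cond_patch\<close>), so no constant \<open>k\<close> is better than \<open>g\<close>.  In the same way, no
  constant is worse than \<open>f\<close>.  All constants would then be indifferent given \<open>A\<close>, contrary to
  non-triviality.
\<close>

section \<open>Local comparisons under the sure-thing axioms\<close>

lemma mix_apply: "mix f A g s = (if s \<in> A then f s else g s)"
  by (simp add: override_on_def)

lemma mix_in_acts:
  assumes "sigma_algebra UNIV Sig" and "f \<in> acts Sig" "g \<in> acts Sig" "A \<in> Sig"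
  shows "mix f A g \<in> acts Sig"
proof -
  interpret sigma_algebra UNIV Sig by fact
  have "range (mix f A g) \<subseteq> range f \<union> range g"
    by (auto simp: override_on_def)
  then have "finite (range (mix f A g))"
    using assms(2,3) unfolding acts_def by (auto intro: finite_subset)
  moreover have "mix f A g -` {c} \<in> Sig" for c
  proof -
    have "mix f A g -` {c} = (f -` {c} \<inter> A) \<union> (g -` {c} - A)"
      by (auto simp: override_on_def)
    moreover have "f -` {c} \<in> Sig" "g -` {c} \<in> Sig"
      using assms(2,3) unfolding acts_def by auto
    ultimately show ?thesis using assms(4) by auto
  qed
  ultimately show ?thesis unfolding acts_def by blast
qed

lemma agrees_sym: "agrees Sig R R' \<longleftrightarrow> agrees Sig R' R"
  unfolding agrees_def by auto

locale sure_thing_preferences =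
  fixes Sig :: "'s set set" and C :: "'s set \<Rightarrow> ('s, 'o) preference"
  assumes sigma: "sigma_algebra UNIV Sig"
    and weak_order: "\<And>A. A \<in> Sig \<Longrightarrow> weak_order_on (acts Sig) (C A)"
    and p1: "P1_half Sig C" and p2: "P2_half Sig C"
begin

sublocale sigma_algebra UNIV Sig by (rule sigma)

lemmas mix_acts [simp] = mix_in_acts [OF sigma]

lemma cond_trans:
  "\<lbrakk>A \<in> Sig; f \<in> acts Sig; g \<in> acts Sig; h \<in> acts Sig; C A f g; C A g h\<rbrakk> \<Longrightarrow> C A f h"
  using weak_order unfolding weak_order_on_def transp_on_def by blast

lemma strict_iff_not:
  "\<lbrakk>A \<in> Sig; f \<in> acts Sig; g \<in> acts Sig\<rbrakk> \<Longrightarrow> strict (C A) f g \<longleftrightarrow> \<not> C A g f"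
  using weak_order unfolding weak_order_on_def strict_def by blast

lemma cond_refl: "\<lbrakk>A \<in> Sig; f \<in> acts Sig\<rbrakk> \<Longrightarrow> C A f f"
  using weak_order unfolding weak_order_on_def by blast

lemma cond_cong:
  assumes "A \<in> Sig" "f \<in> acts Sig" "g \<in> acts Sig" "f' \<in> acts Sig" "g' \<in> acts Sig"
    and "\<And>s. s \<in> A \<Longrightarrow> f s = f' s" "\<And>s. s \<in> A \<Longrightarrow> g s = g' s"
  shows "C A f g \<longleftrightarrow> C A f' g'"
proof -
  have "mix f A f = mix f' A f" "mix g A f = mix g' A f"
    using assms(6,7) by (auto simp: override_on_def fun_eq_iff)
  moreover have "C A u v \<longleftrightarrow> C A (mix u A f) (mix v A f)"
    if "u \<in> acts Sig" "v \<in> acts Sig" for u v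
    using p1 assms(1,2) that unfolding P1_half_def by blast
  ultimately show ?thesis using assms(2-5) by metis
qed

lemma strict_cond_cong:
  assumes "A \<in> Sig" "f \<in> acts Sig" "g \<in> acts Sig" "f' \<in> acts Sig" "g' \<in> acts Sig"
    and "\<And>s. s \<in> A \<Longrightarrow> f s = f' s" "\<And>s. s \<in> A \<Longrightarrow> g s = g' s"
  shows "strict (C A) f g \<longleftrightarrow> strict (C A) f' g'"
proof -
  have "C A f g \<longleftrightarrow> C A f' g'" using assms by (intro cond_cong)
  moreover have "C A g f \<longleftrightarrow> C A g' f'" using assms by (intro cond_cong)
  ultimately show ?thesis unfolding strict_def by simp
qed

lemma cond_eq_on:
  assumes "A \<in> Sig" "f \<in> acts Sig" "g \<in> acts Sig" "\<And>s. s \<in> A \<Longrightarrow> f s = g s"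
  shows "C A f g"
proof -
  have "C A f g \<longleftrightarrow> C A g g" using assms by (intro cond_cong) auto
  then show ?thesis using cond_refl assms(1,3) by simp
qed

lemma null_at_empty: "null_at Sig C {} A"
  unfolding null_at_def agrees_def by simp

text \<open>
  Acts that coincide on \<open>A - B\<close> are indifferent there, so the two parts of the second sure-thing
  axiom carry weak and strict verdicts from \<open>B\<close> to \<open>A\<close>; completeness turns them into an
  equivalence.
\<close>

lemma cond_iff_local:
  assumes "A \<in> Sig" "B \<in> Sig" "B \<subseteq> A" "f \<in> acts Sig" "g \<in> acts Sig"
    and eq: "\<And>s. s \<in> A - B \<Longrightarrow> f s = g s"
  shows "C A f g \<longleftrightarrow> null_at Sig C B A \<or> C B f g"
proof (cases "null_at Sig C B A")
  case True
  then show ?thesis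
    using cond_eq_on [of "A - B" f g] assms(1,2,4,5) eq unfolding null_at_def agrees_def by auto
next
  case False
  have fg: "C (A - B) f g" using assms(1,2,4,5) eq by (intro cond_eq_on) auto
  have gf: "C (A - B) g f" using assms(1,2,4,5) eq [symmetric] by (intro cond_eq_on) auto
  have "C A f g" if "C B f g"
    using p2 assms(1-5) fg that unfolding P2_half_def by simp
  moreover have "strict (C A) g f" if "strict (C B) g f"
    using p2 assms(1-5) gf False that unfolding P2_half_def by simp
  ultimately show ?thesis
    using assms(1,2,4,5) False by (auto simp: strict_iff_not)
qed

lemma strict_cond_iff_local:
  assumes "A \<in> Sig" "B \<in> Sig" "B \<subseteq> A" "f \<in> acts Sig" "g \<in> acts Sig"
    and "\<And>s. s \<in> A - B \<Longrightarrow> f s = g s"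
  shows "strict (C A) f g \<longleftrightarrow> \<not> null_at Sig C B A \<and> strict (C B) f g"
proof -
  have "C A g f \<longleftrightarrow> null_at Sig C B A \<or> C B g f"
    using assms(1-5) assms(6) [symmetric] by (intro cond_iff_local) auto
  then show ?thesis using assms(1-5) by (simp add: strict_iff_not)
qed

text \<open>
  Savage's sure-thing principle for a single conditional preference: the common values outside
  \<open>B\<close> do not matter.
\<close>

lemma sure_thing:
  assumes "A \<in> Sig" "B \<in> Sig" "B \<subseteq> A"
    and "f \<in> acts Sig" "g \<in> acts Sig" "f' \<in> acts Sig" "g' \<in> acts Sig"
    and "\<And>s. s \<notin> B \<Longrightarrow> f s = g s" "\<And>s. s \<notin> B \<Longrightarrow> f' s = g' s"
    and "\<And>s. s \<in> B \<Longrightarrow> f s = f' s" "\<And>s. s \<in> B \<Longrightarrow> g s = g' s"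
  shows "C A f g \<longleftrightarrow> C A f' g'"
proof -
  have "C A f g \<longleftrightarrow> null_at Sig C B A \<or> C B f g"
    using assms(1-5,8) by (intro cond_iff_local) auto
  moreover have "C A f' g' \<longleftrightarrow> null_at Sig C B A \<or> C B f' g'"
    using assms(1-3,6,7,9) by (intro cond_iff_local) auto
  moreover have "C B f g \<longleftrightarrow> C B f' g'"
    using assms(2,4-7,10,11) by (intro cond_cong)
  ultimately show ?thesis by simp
qed

text \<open>
  Passing from \<open>g\<close> to \<open>f\<close> one cell at a time, each step is, by the sure-thing principle, judged
  like the change on that cell alone.
\<close>

lemma cond_patch:
  assumes A: "A \<in> Sig" and P: "finite_event_partition Sig A P"
    and f: "f \<in> acts Sig" and g: "g \<in> acts Sig"
    and cell: "\<And>B. B \<in> P \<Longrightarrow> C A (mix f B g) g"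
  shows "C A f g"
proof -
  have fin: "finite P" and PSig: "P \<subseteq> Sig" and UP: "\<Union>P = A" and disj: "disjoint P"
    using P unfolding finite_event_partition_def partition_on_def by auto
  have "C A (mix f (\<Union>U) g) g" if "finite U" "U \<subseteq> P" for U
    using that
  proof (induction U)
    case empty
    then show ?case using cond_refl A g by simp
  next
    case (insert B U)
    have B: "B \<in> P" "B \<in> Sig" "B \<subseteq> A" and U: "\<Union>U \<in> Sig"
      using insert.hyps insert.prems PSig UP by auto
    then have BU_Sig: "\<Union>(insert B U) \<in> Sig" by auto
    have "B \<inter> V = {}" if "V \<in> U" for V
      using insert.hyps insert.prems that by (intro disjointD [OF disj]) auto
    then have BU: "s \<notin> \<Union>U" if "s \<in> B" for s
      using that by blast
    have "C A (mix f B (mix f (\<Union>U) g)) (mix f (\<Union>U) g) \<longleftrightarrow> C A (mix f B g) g"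
      using A B U f g BU by (intro sure_thing [of A B]) auto
    moreover have "mix f B (mix f (\<Union>U) g) = mix f (\<Union>(insert B U)) g"
      by (auto simp: override_on_def)
    ultimately have "C A (mix f (\<Union>(insert B U)) g) (mix f (\<Union>U) g)"
      using cell B by simp
    moreover have "C A (mix f (\<Union>U) g) g"
      using insert.IH insert.prems by simp
    ultimately show ?case
      using cond_trans mix_acts A U BU_Sig f g by blast
  qed
  from this [OF fin] have "C A (mix f A g) g" using UP by simp
  then show ?thesis
    using cond_cong [of A "mix f A g" g f g] A f g by simp
qed

end

section \<open>Null events\<close>

text \<open>
  With a pair of constants that is strictly ranked given every non-empty event, nullness can be
  tested by betting on an event, and so behaves like measure zero.
\<close>

locale nontrivial_preferences = sure_thing_preferences Sig C
  for Sig :: "'s set set" and C :: "'s set \<Rightarrow> ('s, 'o) preference" +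
  fixes x y :: "'s \<Rightarrow> 'o"
  assumes x: "x \<in> acts Sig" and y: "y \<in> acts Sig"
    and better: "\<And>A. \<lbrakk>A \<in> Sig; A \<noteq> {}\<rbrakk> \<Longrightarrow> strict (C A) x y"
begin

text \<open>
  The bet on \<open>B\<close> differs from \<open>y\<close> only on \<open>B\<close>, and given a non-empty \<open>B\<close> it is as good as \<open>x\<close>;
  so whether it beats \<open>y\<close> at \<open>A\<close> depends only on whether \<open>B\<close> counts there.
\<close>

lemma bet_iff_non_null:
  assumes "A \<in> Sig" "B \<in> Sig" "B \<subseteq> A"
  shows "strict (C A) (mix x B y) y \<longleftrightarrow> \<not> null_at Sig C B A"
proof (cases "B = {}")
  case True
  then show ?thesis by (simp add: null_at_empty strict_def)
next
  case False
  have "strict (C B) (mix x B y) y"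
    using strict_cond_cong [of B "mix x B y" y x y] better [of B] False assms x y by simp
  then show ?thesis
    using strict_cond_iff_local [of A B "mix x B y" y] assms x y by simp
qed

text \<open>
  The bet on \<open>D\<close> coincides with \<open>y\<close> outside \<open>B\<close>, so it beats \<open>y\<close> at \<open>A\<close> exactly if \<open>B\<close> counts at
  \<open>A\<close> and it beats \<open>y\<close> at \<open>B\<close>.
\<close>

lemma null_at_trans_iff:
  assumes "A \<in> Sig" "B \<in> Sig" "D \<in> Sig" "D \<subseteq> B" "B \<subseteq> A"
  shows "null_at Sig C D A \<longleftrightarrow> null_at Sig C B A \<or> null_at Sig C D B"
proof -
  have "strict (C A) (mix x D y) y \<longleftrightarrow> \<not> null_at Sig C B A \<and> strict (C B) (mix x D y) y"
    using assms x y by (intro strict_cond_iff_local) (auto simp: mix_apply)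
  then show ?thesis
    using assms bet_iff_non_null [of A D] bet_iff_non_null [of B D] by auto
qed

text \<open>
  Neither extending the bet from nothing to \<open>D\<close> nor from \<open>D\<close> to \<open>B \<union> D\<close> is an improvement, since
  each step changes the act only on a null event.
\<close>

lemma null_at_Un:
  assumes "A \<in> Sig" "B \<in> Sig" "D \<in> Sig" "B \<subseteq> A" "D \<subseteq> A"
    and "null_at Sig C B A" "null_at Sig C D A"
  shows "null_at Sig C (B \<union> D) A"
proof -
  have BD: "B \<union> D \<in> Sig" using assms by auto
  have "C A y (mix x D y)"
    using assms x y by (subst cond_iff_local [of A D]) auto
  moreover have "C A (mix x D y) (mix x (B \<union> D) y)"
    using assms x y BD by (subst cond_iff_local [of A B]) (auto simp: mix_apply)
  ultimately have "C A y (mix x (B \<union> D) y)"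
    using cond_trans [of A y "mix x D y" "mix x (B \<union> D) y"] assms(1,3) x y BD by simp
  then show ?thesis
    using bet_iff_non_null [of A "B \<union> D"] assms(1,4,5) BD unfolding strict_def by simp
qed

text \<open>
  Otherwise the first implication in \<open>SE\<close> would make \<open>B\<close> null at \<open>B\<close> itself, where \<open>x\<close> is
  strictly better than \<open>y\<close>.
\<close>

lemma ex_non_null:
  assumes "SE Sig C \<E>" "B \<in> Sig" "B \<noteq> {}"
  obtains E where "E \<in> \<E>" "B \<subseteq> E" "\<not> null_at Sig C B E"
proof -
  have "strict (C B) (mix x B y) y"
    using strict_cond_cong [of B "mix x B y" y x y] better [of B] assms x y by simp
  then have "\<not> null_at Sig C B B"
    using bet_iff_non_null [of B B] assms by simp
  then have "\<not> agrees Sig (C B) (C (B - B))"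
    unfolding null_at_def by (subst agrees_sym)
  then obtain E where "E \<in> \<E>" "B \<subseteq> E" "\<not> agrees Sig (C E) (C (E - B))"
    using assms(1,2) unfolding SE_def by blast
  then show ?thesis
    using that unfolding null_at_def by (subst (asm) agrees_sym)
qed

section \<open>From conditional to unconditional preference\<close>

text \<open>
  Every member of \<open>\<E>\<close> that prefers \<open>g\<close> is contained in one that prefers \<open>f\<close>, because both verdicts
  rest on what happens inside \<open>A\<close>; and some member of \<open>\<E>\<close> prefers \<open>f\<close> without being overruled.
\<close>

lemma strict_cond_imp_strict:
  assumes SE: "SE Sig C \<E>" and P0: "P0_half Sig R C \<E>"
    and A: "A \<in> Sig" and f: "f \<in> acts Sig" and g: "g \<in> acts Sig"
    and eq: "\<And>s. s \<notin> A \<Longrightarrow> f s = g s" and fg: "strict (C A) f g"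
  shows "strict R f g"
proof -
  have EvSig: "E \<in> Sig" if "E \<in> \<E>" for E using SE that unfolding SE_def by auto
  have "A \<noteq> {}"
    using fg A f g cond_eq_on [of "{}" g f] by (auto simp: strict_iff_not)
  have overruled: "\<exists>E'\<in>\<E>. E \<subseteq> E' \<and> strict (C E') f g" if E: "E \<in> \<E>" and gf: "strict (C E) g f" for E
  proof -
    have ES: "E \<in> Sig" using E EvSig by blast
    have "strict (C E) g f \<longleftrightarrow> \<not> null_at Sig C (A \<inter> E) E \<and> strict (C (A \<inter> E)) g f"
      using A ES f g eq [symmetric] by (intro strict_cond_iff_local) auto
    then have nonnull_AE: "\<not> null_at Sig C (A \<inter> E) E" using gf by simp
    \<comment> \<open>Choosing \<open>E'\<close> for the union keeps open which of \<open>A\<close> and \<open>E\<close> counts at \<open>E'\<close>; it is at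
      least one of them, and \<open>E\<close> can count only together with its part inside \<open>A\<close>.\<close>
    obtain E' where E': "E' \<in> \<E>" "A \<union> E \<subseteq> E'" "\<not> null_at Sig C (A \<union> E) E'"
      using ex_non_null [OF SE, of "A \<union> E"] A ES \<open>A \<noteq> {}\<close> by auto
    have E'S: "E' \<in> Sig" using E' EvSig by blast
    have "\<not> null_at Sig C A E'"
    proof
      assume null: "null_at Sig C A E'"
      then have "\<not> null_at Sig C E E'"
        using null_at_Un [of E' A E] E' E'S A ES by auto
      then have "\<not> null_at Sig C (A \<inter> E) E'"
        using null_at_trans_iff [of E' E "A \<inter> E"] nonnull_AE E' E'S A ES by auto
      then show False
        using null null_at_trans_iff [of E' A "A \<inter> E"] E' E'S A ES by auto
    qed
    then have "strict (C E') f g"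
      using fg strict_cond_iff_local [of E' A f g] E' E'S A f g eq by auto
    then show ?thesis using E' by auto
  qed
  obtain E0 where E0: "E0 \<in> \<E>" "A \<subseteq> E0" "\<not> null_at Sig C A E0"
    using ex_non_null [OF SE A \<open>A \<noteq> {}\<close>] .
  have "strict (C E0) f g"
    using fg strict_cond_iff_local [of E0 A f g] E0 EvSig A f g eq by auto
  moreover have "\<not> strict (C E') g f" if "E' \<in> \<E>" "E0 \<subseteq> E'" for E'
  proof -
    have "strict (C E') g f \<longleftrightarrow> \<not> null_at Sig C A E' \<and> strict (C A) g f"
      using that E0 EvSig A f g eq [symmetric] by (intro strict_cond_iff_local) auto
    then show ?thesis using fg unfolding strict_def by blast
  qed
  ultimately have "\<not> R g f"
    using P0 E0 f g unfolding P0_half_def by blast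
  moreover have "R f g"
    using P0 f g overruled unfolding P0_half_def by blast
  ultimately show ?thesis unfolding strict_def by blast
qed

end

theorem theorem4:
  fixes Sig :: "'s set set"
    and R :: "('s, 'o) preference"
    and C :: "'s set \<Rightarrow> ('s, 'o) preference"
    and \<E> :: "'s set set"
  assumes "infinite (UNIV :: 's set)"
    and "sigma_algebra UNIV Sig"
    and "weak_order_on (acts Sig) R"
    and "\<And>A. A \<in> Sig \<Longrightarrow> weak_order_on (acts Sig) (C A)"
    and "P1_half Sig C" and "P2_half Sig C" and "P3_half Sig C"
    and "P4_half Sig C" and "P5_half Sig C" and "P6_half Sig C"
    and "SE Sig C \<E>" and "P0_half Sig R C \<E>"
  shows "\<forall>A\<in>Sig. A \<noteq> {} \<longrightarrow>
    (\<forall>f\<in>acts Sig. \<forall>g\<in>acts Sig. \<forall>h\<in>acts Sig.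
       strict (C A) f g \<longleftrightarrow>
         strict R (mix f A h) (mix g A h) \<and>
         (\<forall>k\<in>const_acts Sig. \<exists>P. finite_event_partition Sig A P \<and>
            (\<forall>B\<in>P. strict R (mix k B (mix f A h)) (mix g A h) \<and>
                    strict R (mix f A h) (mix k B (mix g A h)))))"
proof (intro ballI impI)
  fix A and f g h :: "'s \<Rightarrow> 'o"
  assume A: "A \<in> Sig" and "A \<noteq> {}"
    and f: "f \<in> acts Sig" and g: "g \<in> acts Sig" and h: "h \<in> acts Sig"
  note P3 = assms(7) and P6 = assms(10) and SE = assms(11) and P0 = assms(12)
  obtain x y where xc: "x \<in> const_acts Sig" and yc: "y \<in> const_acts Sig"
    and xy: "strict (C UNIV) x y"
    using assms(9) unfolding P5_half_def by blast
  have const: "k \<in> acts Sig" if "k \<in> const_acts Sig" for k :: "'s \<Rightarrow> 'o"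
    using that unfolding const_acts_def by simp
  have "strict (C D) x y" if "D \<in> Sig" "D \<noteq> {}" for D
    using P3 xc yc xy that unfolding P3_half_def strict_def by blast
  then interpret nontrivial_preferences Sig C x y
    by (intro nontrivial_preferences.intro sure_thing_preferences.intro
        nontrivial_preferences_axioms.intro assms(2,4-6) const xc yc)
  let ?f = "mix f A h" and ?g = "mix g A h"
  have acts: "?f \<in> acts Sig" "?g \<in> acts Sig" using A f g h by auto
  have cond_mix: "strict (C A) u v \<longleftrightarrow> strict (C A) (mix u A h) (mix v A h)"
    if "u \<in> acts Sig" "v \<in> acts Sig" for u v
    using that A h by (intro strict_cond_cong) auto
  have forward: "strict R u v"
    if "u \<in> acts Sig" "v \<in> acts Sig" "strict (C A) u v" "\<And>s. s \<notin> A \<Longrightarrow> u s = v s" for u v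
    using strict_cond_imp_strict [OF SE P0 A] that by blast
  have cells: "B \<in> Sig" "B \<subseteq> A" if "finite_event_partition Sig A P" "B \<in> P" for P B
    using that unfolding finite_event_partition_def partition_on_def by auto
  let ?robust = "\<forall>k\<in>const_acts Sig. \<exists>P. finite_event_partition Sig A P \<and>
    (\<forall>B\<in>P. strict R (mix k B ?f) ?g \<and> strict R ?f (mix k B ?g))"
  show "strict (C A) f g \<longleftrightarrow> strict R ?f ?g \<and> ?robust"
  proof (intro iffI conjI ballI)
    assume fg: "strict (C A) f g"
    then have FG: "strict (C A) ?f ?g" using cond_mix f g by blast
    then show "strict R ?f ?g" using forward acts by simp
    fix k :: "'s \<Rightarrow> 'o"
    assume k: "k \<in> const_acts Sig"
    then obtain P where P: "finite_event_partition Sig A P"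
      and robust: "\<And>B. B \<in> P \<Longrightarrow> strict (C A) ?f (mix k B ?g) \<and> strict (C A) (mix k B ?f) ?g"
      using P6 A \<open>A \<noteq> {}\<close> acts FG unfolding P6_half_def by metis
    have "strict R (mix k B ?f) ?g \<and> strict R ?f (mix k B ?g)" if B: "B \<in> P" for B
    proof
      note BA = cells [OF P B]
      then show "strict R (mix k B ?f) ?g" "strict R ?f (mix k B ?g)"
        using robust [OF B] acts const [OF k] by (auto intro!: forward simp: mix_apply)
    qed
    then show "\<exists>P. finite_event_partition Sig A P \<and>
      (\<forall>B\<in>P. strict R (mix k B ?f) ?g \<and> strict R ?f (mix k B ?g))"
      using P by blast
  next
    assume R: "strict R ?f ?g \<and> ?robust"
    have cond_if_strict: "C A u v"
      if "u \<in> acts Sig" "v \<in> acts Sig" "strict R u v" "\<And>s. s \<notin> A \<Longrightarrow> u s = v s" for u v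
    proof (rule ccontr)
      assume "\<not> C A u v"
      then have "strict R v u"
        using that A by (intro forward) (auto simp: strict_iff_not)
      then show False using that(3) unfolding strict_def by blast
    qed
    show "strict (C A) f g"
    proof (rule ccontr)
      assume "\<not> strict (C A) f g"
      then have gf: "C A ?g ?f"
        using cond_mix [OF f g] acts A by (simp add: strict_iff_not)
      have fg: "C A ?f ?g"
        using R acts by (intro cond_if_strict) auto
      have between: "C A ?g k" "C A k ?f" if k: "k \<in> const_acts Sig" for k
      proof -
        obtain P where P: "finite_event_partition Sig A P"
          and robust: "\<And>B. B \<in> P \<Longrightarrow> strict R (mix k B ?f) ?g \<and> strict R ?f (mix k B ?g)"
          using R k by blast
        have local: "C A (mix k B ?f) ?f" "C A ?g (mix k B ?g)" if B: "B \<in> P" for B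
        proof -
          note BA = cells [OF P B]
          have mixes: "mix k B ?f \<in> acts Sig" "mix k B ?g \<in> acts Sig"
            using BA acts const [OF k] by auto
          have "C A (mix k B ?f) ?g"
            using robust [OF B] BA acts mixes by (intro cond_if_strict) (auto simp: mix_apply)
          then show "C A (mix k B ?f) ?f"
            using gf acts mixes A cond_trans by blast
          have "C A ?f (mix k B ?g)"
            using robust [OF B] BA acts mixes by (intro cond_if_strict) (auto simp: mix_apply)
          then show "C A ?g (mix k B ?g)"
            using gf acts mixes A cond_trans by blast
        qed
        show "C A k ?f"
          using cond_patch [OF A P const [OF k] acts(1)] local by blast
        \<comment> \<open>Here the patching starts from \<open>k\<close> instead of \<open>?g\<close>: by the sure-thing principle,
          the values that the compared acts share outside the cell can be exchanged.\<close>
        have "C A (mix ?g B k) k" if B: "B \<in> P" for B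
        proof -
          have "C A ?g (mix k B ?g) \<longleftrightarrow> C A (mix ?g B k) k"
            using A cells [OF P B] acts const [OF k]
            by (intro sure_thing [of A B]) (auto simp: mix_apply)
          then show ?thesis using local B by blast
        qed
        then show "C A ?g k"
          using cond_patch [OF A P acts(2) const [OF k]] by blast
      qed
      have "C A y ?f" "C A ?f ?g" "C A ?g x" using between xc yc fg by auto
      then have "C A y x" using A acts x y cond_trans by metis
      then show False
        using better [OF A \<open>A \<noteq> {}\<close>] unfolding strict_def by blast
    qed
  qed
qed

end
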